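(* Every countable Hausdorff Fréchet-Urysohn topological space is $S$-separable.
   Context: A topological space $X$ is Fréchet-Urysohn if for every $A\subset X$ and $x\in\overline{A}\setminus A$ there exists a sequence $\langle x_n:n\in\omega\rangle$ of elements of $A$ converging to $x$. $\omega$ is the set of natural numbers, each $k\in\omega$ is identified with $\{0,\dots,k-1\}$, and $[D]^{<\omega}$ denotes the set of finite subsets of $D$. A topological space $X$ is $S$-separable if for every sequence $\langle D_n:n\in\omega\rangle$ of dense subsets of $X$ there exists a sequence $\langle F_n:n\in\omega\rangle$ such that $F_n\in[D_n]^{<\omega}$ for all $n\in\omega$, and for every finite family $\{U_i:i\in k\}$ of non-empty open subsets of $X$ there exists $n\in\omega$ with $U_i\cap F_n\neq\emptyset$ for all $i\in k$. *)

theory Defs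
  imports "HOL-Analysis.Analysis"
begin

definition Frechet_Urysohn_space :: "'a topology \<Rightarrow> bool" where
  "Frechet_Urysohn_space X \<longleftrightarrow>
     (\<forall>A x. A \<subseteq> topspace X \<and> x \<in> X closure_of A - A \<longrightarrow>
        (\<exists>s :: nat \<Rightarrow> 'a. (\<forall>n. s n \<in> A) \<and> limitin X s x sequentially))"

definition dense_in :: "'a topology \<Rightarrow> 'a set \<Rightarrow> bool" where
  "dense_in X D \<longleftrightarrow> D \<subseteq> topspace X \<and> X closure_of D = topspace X"

text \<open>A finite family indexed by \<open>k = {0, \<dots>, k - 1}\<close> is given by a function on \<open>nat\<close> of which only
  the values below \<open>k\<close> matter; \<open>k\<close> may be \<open>0\<close>, and members may repeat.\<close>

definition S_separable :: "'a topology \<Rightarrow> bool" where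
  "S_separable X \<longleftrightarrow>
     (\<forall>D :: nat \<Rightarrow> 'a set. (\<forall>n. dense_in X (D n)) \<longrightarrow>
        (\<exists>F :: nat \<Rightarrow> 'a set. (\<forall>n. finite (F n) \<and> F n \<subseteq> D n) \<and>
           (\<forall>(k :: nat) (U :: nat \<Rightarrow> 'a set).
              (\<forall>i<k. openin X (U i) \<and> U i \<noteq> {}) \<longrightarrow>
              (\<exists>n. \<forall>i<k. U i \<inter> F n \<noteq> {}))))"

end

theory Submission
  imports Defs
begin

text \<open>
  If \<open>x\<close> is not isolated, pick points \<open>p m \<noteq> x\<close> converging to \<open>x\<close>, and separate \<open>p m\<close> from \<open>x\<close>
  by an open \<open>U m\<close> whose closure misses \<open>x\<close>. Then \<open>x\<close> lies in the closure of
  \<open>\<Union>m. U m \<inter> D m\<close>, and a sequence from this union converging to \<open>x\<close> visits each \<open>U m\<close> only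
  finitely often. Hence there is a sequence converging to \<open>x\<close> whose terms come from the members of
  a subsequence of \<open>D\<close>. Passing to further subsequences handles finitely many points at once. As a
  countable space has only countably many finite subsets, splitting \<open>D\<close> into infinitely many
  subsequences, one for each finite subset, concludes.
\<close>

lemma dense_in_meets_open:
  assumes "dense_in X D" "openin X U" "U \<noteq> {}"
  shows "U \<inter> D \<noteq> {}"
proof -
  obtain y where "y \<in> U" using assms by blast
  moreover from this have "y \<in> X closure_of D"
    using assms openin_subset unfolding dense_in_def by blast
  ultimately show ?thesis
    using assms(2) unfolding in_closure_of by blast
qed

text \<open>Beyond any \<open>j\<close> only finitely many indices have a value of \<open>g\<close>
  at most \<open>g j\<close>, so a larger index with a larger value can always be chosen
  next.\<close>

lemma finite_to_one_strict_mono_subseq: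
  fixes g :: "nat \<Rightarrow> nat"
  assumes "\<And>n. finite {j. g j = n}"
  obtains q :: "nat \<Rightarrow> nat" where "strict_mono q" "strict_mono (g \<circ> q)"
proof -
  have step: "\<exists>j'. j < j' \<and> g j < g j'" for j
  proof -
    have "finite ({..j} \<union> (\<Union>n\<le>g j. {i. g i = n}))" using assms by auto
    then obtain j' where "j' \<notin> {..j} \<union> (\<Union>n\<le>g j. {i. g i = n})"
      using ex_new_if_finite infinite_UNIV_nat by blast
    then show ?thesis by (auto simp: not_le)
  qed
  then obtain q :: "nat \<Rightarrow> nat" where "\<And>n. q n < q (Suc n) \<and> g (q n) < g (q (Suc n))"
    using dependent_nat_choice[of "\<lambda>_ _. True" "\<lambda>_ j j'. j < j' \<and> g j < g j'"] by auto
  then show thesis by (intro that[of q]) (auto simp: strict_mono_Suc_iff)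
qed

lemma convergent_subselection:
  assumes haus: "Hausdorff_space X" and FU: "Frechet_Urysohn_space X"
    and x: "x \<in> topspace X" and dense: "\<And>n. dense_in X (D n)"
  obtains r :: "nat \<Rightarrow> nat" and f where
    "strict_mono r" "\<And>n. f n \<in> D (r n)" "limitin X f x sequentially"
proof (cases "openin X {x}")
  case True
  \<comment> \<open>An isolated point belongs to every dense set, so a constant sequence
    works.\<close>
  then have "x \<in> D n" for n using dense_in_meets_open[OF dense] by blast
  then show thesis using x by (intro that[of id "\<lambda>_. x"]) (auto simp: strict_mono_def)
next
  case False
  have "x \<in> X closure_of (topspace X - {x})"
    unfolding in_closure_of
  proof (intro conjI allI impI x)
    fix T assume T: "x \<in> T \<and> openin X T"
    then have "T \<noteq> {x}" using False by auto
    then show "\<exists>y. y \<in> topspace X - {x} \<and> y \<in> T"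
      using T openin_subset by blast
  qed
  then obtain p :: "nat \<Rightarrow> 'a" where p: "\<And>m. p m \<in> topspace X - {x}"
    and p_lim: "limitin X p x sequentially"
    using FU[unfolded Frechet_Urysohn_space_def, rule_format, of "topspace X - {x}" x] by auto
  have "\<exists>U V. openin X U \<and> openin X V \<and> p m \<in> U \<and> x \<in> V \<and> disjnt U V" for m
    using haus p[of m] x unfolding Hausdorff_space_def by auto
  then obtain U V where U: "\<And>m. openin X (U m)" "\<And>m. p m \<in> U m"
    and V: "\<And>m. openin X (V m)" "\<And>m. x \<in> V m" and UV: "\<And>m. disjnt (U m) (V m)"
    by metis
  let ?A = "\<Union>m. U m \<inter> D m"
  have "x \<in> X closure_of ?A"
    unfolding in_closure_of
  proof (intro conjI allI impI x)
    fix T assume T: "x \<in> T \<and> openin X T"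
    then obtain m where "p m \<in> T"
      using p_lim unfolding limitin_sequentially by blast
    \<comment> \<open>\<open>p m\<close> lies in both \<open>T\<close> and \<open>U m\<close>, so
      density of \<open>D m\<close> applies to their open intersection.\<close>
    then have "T \<inter> U m \<inter> D m \<noteq> {}"
      using T U by (intro dense_in_meets_open[OF dense]) auto
    then show "\<exists>y. y \<in> ?A \<and> y \<in> T" by blast
  qed
  moreover have "x \<notin> ?A" using V(2) UV by (auto simp: disjnt_iff)
  moreover have "?A \<subseteq> topspace X" using U openin_subset by blast
  ultimately obtain a :: "nat \<Rightarrow> 'a" where a: "\<And>j. a j \<in> ?A" and a_lim: "limitin X a x sequentially"
    using FU[unfolded Frechet_Urysohn_space_def, rule_format, of ?A x] by blast
  from a have "\<exists>m. a j \<in> U m \<inter> D m" for j by blast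
  then obtain g where g: "\<And>j. a j \<in> U (g j) \<inter> D (g j)" by metis
  \<comment> \<open>The sequence is eventually in \<open>V m\<close>, which is disjoint from
    \<open>U m\<close>.\<close>
  have "finite {j. g j = m}" for m
  proof -
    have "eventually (\<lambda>j. a j \<in> V m) sequentially"
      using a_lim V unfolding limitin_def by blast
    then have "finite {j. a j \<notin> V m}"
      by (simp add: eventually_cofinite flip: cofinite_eq_sequentially)
    moreover have "{j. g j = m} \<subseteq> {j. a j \<notin> V m}"
      using g UV by (auto simp: disjnt_iff)
    ultimately show ?thesis by (rule rev_finite_subset)
  qed
  then obtain q :: "nat \<Rightarrow> nat" where "strict_mono q" "strict_mono (g \<circ> q)"
    by (rule finite_to_one_strict_mono_subseq)
  then show thesis
    using g a_lim by (intro that[of "g \<circ> q" "a \<circ> q"]) (auto intro: limitin_subsequence)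
qed

text \<open>Asking for "eventually" instead of "for some \<open>n\<close>" makes the property
  survive passage to a subsequence, which the induction on \<open>S\<close> needs, and lets finitely
  many points share one index later.\<close>

lemma finite_set_subselection:
  assumes haus: "Hausdorff_space X" and FU: "Frechet_Urysohn_space X"
    and "finite S" "S \<subseteq> topspace X" and dense: "\<And>n. dense_in X (D n)"
  shows "\<exists>(r :: nat \<Rightarrow> nat) F. strict_mono r \<and> (\<forall>n. finite (F n) \<and> F n \<subseteq> D (r n)) \<and>
    (\<forall>x\<in>S. \<forall>U. openin X U \<and> x \<in> U \<longrightarrow> (\<forall>\<^sub>F n in sequentially. U \<inter> F n \<noteq> {}))"
  using \<open>finite S\<close> \<open>S \<subseteq> topspace X\<close>
proof (induction S)
  case empty
  show ?case by (intro exI[of _ id] exI[of _ "\<lambda>_. {}"]) (auto simp: strict_mono_def)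
next
  case (insert x S)
  then obtain r F where r: "strict_mono (r :: nat \<Rightarrow> nat)"
    and F: "\<And>n. finite (F n)" "\<And>n. F n \<subseteq> D (r n)"
    and ev: "\<And>y U. \<lbrakk>y \<in> S; openin X U; y \<in> U\<rbrakk> \<Longrightarrow> \<forall>\<^sub>F n in sequentially. U \<inter> F n \<noteq> {}"
    by (metis insert_subset)
  \<comment> \<open>The new point is treated inside the subsequence already chosen for
    \<open>S\<close>; the old sets are then thinned along \<open>r'\<close>.\<close>
  obtain r' f where r': "strict_mono (r' :: nat \<Rightarrow> nat)" and f: "\<And>n. f n \<in> D (r (r' n))"
    and lim: "limitin X f x sequentially"
    using convergent_subselection[OF haus FU, of x "\<lambda>n. D (r n)"] insert.prems dense by auto
  define G where "G = (\<lambda>n. insert (f n) (F (r' n)))"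
  have "strict_mono (r \<circ> r')" using r r' by (rule strict_mono_o)
  moreover have "finite (G n) \<and> G n \<subseteq> D ((r \<circ> r') n)" for n
    using F f by (simp add: G_def)
  moreover have "\<forall>\<^sub>F n in sequentially. U \<inter> G n \<noteq> {}"
    if "y \<in> insert x S" "openin X U" "y \<in> U" for y U
  proof (cases "y = x")
    case True
    then have "\<forall>\<^sub>F n in sequentially. f n \<in> U" using lim that unfolding limitin_def by blast
    then show ?thesis by eventually_elim (auto simp: G_def)
  next
    case False
    then have "\<forall>\<^sub>F n in sequentially. U \<inter> F (r' n) \<noteq> {}"
      using ev that eventually_subseq[OF r'] by blast
    then show ?thesis by eventually_elim (auto simp: G_def)
  qed
  ultimately show ?case by blast
qed

lemma finite_set_selection:
  fixes D :: "nat \<Rightarrow> 'a set"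
  assumes "Hausdorff_space X" "Frechet_Urysohn_space X"
    and "finite S" "S \<subseteq> topspace X" and "\<And>n. dense_in X (D n)"
  shows "\<exists>F. (\<forall>n. finite (F n) \<and> F n \<subseteq> D n) \<and>
    (\<forall>U. (\<forall>x\<in>S. openin X (U x) \<and> x \<in> U x) \<longrightarrow> (\<exists>n. \<forall>x\<in>S. U x \<inter> F n \<noteq> {}))"
proof -
  obtain r F where r: "strict_mono (r :: nat \<Rightarrow> nat)"
    and F: "\<forall>n. finite (F n) \<and> F n \<subseteq> D (r n)"
    and ev: "\<forall>y\<in>S. \<forall>U. openin X U \<and> y \<in> U \<longrightarrow> (\<forall>\<^sub>F n in sequentially. U \<inter> F n \<noteq> {})"
    using finite_set_subselection[of X S D] assms by blast
  \<comment> \<open>The selected sets return to their original indices; the skipped indices get the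
    empty set.\<close>
  define G where "G = (\<lambda>m. if m \<in> range r then F (inv r m) else {})"
  have G_r: "G (r n) = F n" for n
    using r by (simp add: G_def strict_mono_imp_inj_on)
  have "finite (G m) \<and> G m \<subseteq> D m" for m
    using F by (cases "m \<in> range r") (auto simp: G_r, auto simp: G_def)
  moreover have "\<exists>m. \<forall>x\<in>S. U x \<inter> G m \<noteq> {}" if "\<forall>x\<in>S. openin X (U x) \<and> x \<in> U x" for U
  proof -
    have "\<forall>\<^sub>F n in sequentially. \<forall>x\<in>S. U x \<inter> F n \<noteq> {}"
      using that ev \<open>finite S\<close> by (intro eventually_ball_finite) auto
    then obtain n where "\<forall>x\<in>S. U x \<inter> F n \<noteq> {}"
      using eventually_happens' sequentially_bot by blast
    then show ?thesis by (metis G_r)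
  qed
  ultimately show ?thesis by blast
qed

theorem theorem1p8:
  fixes X :: "'a topology"
  assumes "countable (topspace X)"
    and "Hausdorff_space X"
    and "Frechet_Urysohn_space X"
  shows "S_separable X"
  unfolding S_separable_def
proof (intro allI impI)
  fix D :: "nat \<Rightarrow> 'a set"
  assume dense: "\<forall>n. dense_in X (D n)"
  define \<S> where "\<S> = {S. finite S \<and> S \<subseteq> topspace X}"
  have "countable \<S>"
    using countable_Collect_finite_subset[OF assms(1)] by (simp add: \<S>_def)
  \<comment> \<open>Nonemptiness ensures that \<open>from_nat_into\<close> takes values in the
    family only.\<close>
  have "{} \<in> \<S>" by (simp add: \<S>_def)
  define e where "e = from_nat_into \<S>"
  have e: "finite (e i)" "e i \<subseteq> topspace X" for i
    using from_nat_into[of \<S> i] \<open>{} \<in> \<S>\<close> by (auto simp: e_def \<S>_def)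
  \<comment> \<open>The indices \<open>prod_encode (i, n)\<close> with \<open>i\<close> fixed form
    the subsequence reserved for the finite set \<open>e i\<close>; different \<open>i\<close> give
    disjoint sets of indices.\<close>
  have "\<exists>F. (\<forall>n. finite (F n) \<and> F n \<subseteq> D (prod_encode (i, n))) \<and>
    (\<forall>U. (\<forall>x\<in>e i. openin X (U x) \<and> x \<in> U x) \<longrightarrow> (\<exists>n. \<forall>x\<in>e i. U x \<inter> F n \<noteq> {}))" for i
    using finite_set_selection[OF assms(2,3) e] dense by simp
  then obtain F where F: "\<And>i n. finite (F i n) \<and> F i n \<subseteq> D (prod_encode (i, n))"
    and meets: "\<And>i U. \<forall>x\<in>e i. openin X (U x) \<and> x \<in> U x \<Longrightarrow> \<exists>n. \<forall>x\<in>e i. U x \<inter> F i n \<noteq> {}"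
    by metis
  define G where "G = (\<lambda>m. case prod_decode m of (i, n) \<Rightarrow> F i n)"
  have G: "G (prod_encode (i, n)) = F i n" for i n by (simp add: G_def)
  have "finite (G m) \<and> G m \<subseteq> D m" for m
    using F G by (metis prod_decode_inverse surj_pair)
  moreover have "\<exists>m. \<forall>i<k. U i \<inter> G m \<noteq> {}"
    if U: "\<forall>i<k. openin X (U i) \<and> U i \<noteq> {}" for k :: nat and U
  proof -
    have "\<forall>i. \<exists>x. i < k \<longrightarrow> x \<in> U i" using U by blast
    then obtain y where y: "\<And>i. i < k \<Longrightarrow> y i \<in> U i" by metis
    \<comment> \<open>One point from each \<open>U i\<close> gives a finite set, which occurs in the
      enumeration as some \<open>e j\<close>; the subsequence reserved for it serves this
      family.\<close>
    have "y ` {..<k} \<in> \<S>" using y U openin_subset by (fastforce simp: \<S>_def)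
    then obtain j where j: "e j = y ` {..<k}"
      using from_nat_into_surj[OF \<open>countable \<S>\<close>] unfolding e_def by blast
    \<comment> \<open>\<open>y\<close> need not be injective, so each \<open>y i\<close> gets the intersection of all \<open>U i'\<close> with \<open>y i' = y i\<close>.\<close>
    define W where "W = (\<lambda>x. \<Inter>(U ` {i. i < k \<and> y i = x}))"
    have "\<forall>x\<in>e j. openin X (W x) \<and> x \<in> W x"
    proof
      fix x assume "x \<in> e j"
      \<comment> \<open>An intersection over no sets would be \<open>UNIV\<close>, which need not be
        open in \<open>X\<close>.\<close>
      then have "{i. i < k \<and> y i = x} \<noteq> {}" using j by auto
      then show "openin X (W x) \<and> x \<in> W x"
        using U unfolding W_def by (intro conjI openin_Inter) (auto dest: y)
    qed
    then obtain n where "\<forall>x\<in>e j. W x \<inter> F j n \<noteq> {}" using meets by blast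
    moreover have "W (y i) \<subseteq> U i" if "i < k" for i
      using that by (auto simp: W_def)
    ultimately have "\<forall>i<k. U i \<inter> F j n \<noteq> {}" unfolding j by blast
    then show ?thesis by (metis G)
  qed
  ultimately show "\<exists>F. (\<forall>n. finite (F n) \<and> F n \<subseteq> D n) \<and>
      (\<forall>(k :: nat) U. (\<forall>i<k. openin X (U i) \<and> U i \<noteq> {}) \<longrightarrow> (\<exists>n. \<forall>i<k. U i \<inter> F n \<noteq> {}))"
    by blast
qed

end
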